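(* Let $D_x, D_s, D_e\ge 1$ be integers with $D_x>D_e$, and let $p,q\ge 0$ be integers. Let $\mathbf{e}=(\mathbf{e}(t))_{t\in\mathbb{Z}}$ be an $\mathbb{R}^{D_e}$-valued process, i.i.d. in time $t$, with zero mean and finite second moments, of the form $\mathbf{e}(t)=[\mathbf{e}^1(t);\ldots;\mathbf{e}^M(t)]$ (concatenation), where $\mathbf{e}^m(t)\in\mathbb{R}^{d_e^m}$, $\sum_{m=1}^M d_e^m=D_e$, and the components $\mathbf{e}^1,\ldots,\mathbf{e}^M$ are jointly independent. Let $\mathbf{A}\in\mathbb{R}^{D_x\times D_s}$, $\mathbf{P}[z]=\mathbf{I}_{D_s}-\sum_{i=1}^{p}\mathbf{P}_i z^i$ with $\mathbf{P}_i\in\mathbb{R}^{D_s\times D_s}$, and $\mathbf{Q}[z]=\sum_{j=0}^{q}\mathbf{Q}_j z^j$ with $\mathbf{Q}_j\in\mathbb{R}^{D_s\times D_e}$. Assume that: (i) $\mathbf{P}[z]$ is stable, i.e. $\det(\mathbf{P}[z])\neq 0$ for all $z\in\mathbb{C}$ with $|z|\le 1$; (ii) $\mathbf{A}$ is of full column rank; (iii) $\mathbf{Q}[z]$ has a polynomial left inverse, i.e. there is a polynomial matrix $\mathbf{W}[z]\in\mathbb{R}[z]^{D_e\times D_s}$ with $\mathbf{W}[z]\mathbf{Q}[z]=\mathbf{I}_{D_e}$. Let $\mathbf{s}=(\mathbf{s}(t))_{t\in\mathbb{Z}}$ be the stationary $\mathbb{R}^{D_s}$-valued ARMA$(p,q)$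 process satisfying $\mathbf{P}[z]\mathbf{s}=\mathbf{Q}[z]\mathbf{e}$, and let $\mathbf{x}=\mathbf{A}\mathbf{s}$, i.e. $\mathbf{x}(t)=\mathbf{A}\mathbf{s}(t)$ for all $t$. Then the process $\mathbf{x}(t)$ is autoregressive, and its innovation satisfies $$\tilde{\mathbf{x}}(t):=\mathbf{x}(t)-E[\mathbf{x}(t)\mid \mathbf{x}(t-1),\mathbf{x}(t-2),\ldots]=\mathbf{A}\mathbf{Q}_0\mathbf{e}(t).$$ Consequently, there is a polynomial matrix $\mathbf{W}_{\mathrm{AR}}[z]\in\mathbb{R}[z]^{D_x\times D_x}$ such that $\mathbf{W}_{\mathrm{AR}}[z]\mathbf{x}=\mathbf{A}\mathbf{Q}_0\mathbf{e}$.
   Context: Here $z$ denotes the time-shift operation $(z\mathbf{v})(t):=\mathbf{v}(t-1)$, and a polynomial matrix $\mathbf{F}[z]=\sum_{n=0}^N\mathbf{F}_n z^n$ with $\mathbf{F}_n\in\mathbb{R}^{D_1\times D_2}$ acts on an $\mathbb{R}^{D_2}$-valued process $\mathbf{v}$ by $(\mathbf{F}[z]\mathbf{v})(t)=\sum_{n=0}^N\mathbf{F}_n\mathbf{v}(t-n)$. The set of all such polynomial matrices (of arbitrary degree) is $\mathbb{R}[z]^{D_1\times D_2}$. In evaluating $\det(\mathbf{P}[z])$ for $z\in\mathbb{C}$, $z$ is treated as a complex variable. Thus $\mathbf{P}[z]\mathbf{s}=\mathbf{Q}[z]\mathbf{e}$ means $\mathbf{s}(t)=\sum_{i=1}^{p}\mathbf{P}_i\mathbf{s}(t-i)+\sum_{j=0}^{q}\mathbf{Q}_j\mathbf{e}(t-j)$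 for all $t$. $E[\cdot\mid\cdot]$ is conditional expectation. The process $\mathbf{x}$ is autoregressive (with innovation $\tilde{\mathbf{x}}$) if there are a finite $L$ and matrices $\mathbf{F}_1,\ldots,\mathbf{F}_L\in\mathbb{R}^{D_x\times D_x}$ with $\mathbf{x}(t)=\sum_{i=1}^{L}\mathbf{F}_i\mathbf{x}(t-i)+\tilde{\mathbf{x}}(t)$ for all $t$. Equalities between random variables are understood almost surely. *)

theory Defs
  imports
    "HOL-Probability.Probability"
    "HOL-Computational_Algebra.Polynomial"
begin

(* A polynomial matrix in R[z]^(D1 x D2) is a matrix over the ring of real polynomials, i.e. a term
   of type real poly ^ 'd2 ^ 'd1; its product is the library matrix product and mat 1 its unit. *)

text \<open>\<open>pmat_monom C n\<close> is the polynomial matrix $C z^n$.\<close>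

definition pmat_monom :: "real ^ 'n ^ 'm \<Rightarrow> nat \<Rightarrow> real poly ^ 'n ^ 'm" where
  "pmat_monom C n = (\<chi> i j. monom (C $ i $ j) n)"

definition pmat_coeff :: "real poly ^ 'n ^ 'm \<Rightarrow> nat \<Rightarrow> real ^ 'n ^ 'm" where
  "pmat_coeff F n = (\<chi> i j. coeff (F $ i $ j) n)"

definition pmat_degree :: "real poly ^ 'n ^ 'm \<Rightarrow> nat" where
  "pmat_degree F = Max (range (\<lambda>(i, j). degree (F $ i $ j)))"

definition pmat_eval :: "real poly ^ 'n ^ 'm \<Rightarrow> complex \<Rightarrow> complex ^ 'n ^ 'm" where
  "pmat_eval F z = (\<chi> i j. poly (map_poly complex_of_real (F $ i $ j)) z)"

text \<open>The action $(F[z]v)(t) = \sum_n F_n v(t-n)$, with $z$ read as the time shift.\<close>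

definition pmat_act :: "real poly ^ 'n ^ 'm \<Rightarrow> (int \<Rightarrow> real ^ 'n) \<Rightarrow> int \<Rightarrow> real ^ 'm" where
  "pmat_act F v t = (\<Sum>n\<le>pmat_degree F. pmat_coeff F n *v v (t - int n))"

definition pmat_stable :: "real poly ^ 'n ^ 'n \<Rightarrow> bool" where
  "pmat_stable P \<longleftrightarrow> (\<forall>z. norm z \<le> 1 \<longrightarrow> det (pmat_eval P z) \<noteq> 0)"

definition ar_pmat :: "nat \<Rightarrow> (nat \<Rightarrow> real ^ 'n ^ 'n) \<Rightarrow> real poly ^ 'n ^ 'n" where
  "ar_pmat p P = mat 1 - (\<Sum>i = 1..p. pmat_monom (P i) i)"

definition ma_pmat :: "nat \<Rightarrow> (nat \<Rightarrow> real ^ 'n ^ 'm) \<Rightarrow> real poly ^ 'n ^ 'm" where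
  "ma_pmat q Q = (\<Sum>j\<le>q. pmat_monom (Q j) j)"

lemma pmat_act_eq_sum:
  assumes "\<And>i j. degree (F $ i $ j) \<le> N"
  shows "pmat_act F v t = (\<Sum>n\<le>N. pmat_coeff F n *v v (t - int n))"
proof -
  have deg: "degree (F $ i $ j) \<le> pmat_degree F" for i j
    unfolding pmat_degree_def by (rule Max_ge) auto
  have le: "pmat_degree F \<le> N"
    unfolding pmat_degree_def using assms by (subst Max_le_iff) auto
  show ?thesis
    unfolding pmat_act_def
  proof (rule sum.mono_neutral_left)
    show "\<forall>n\<in>{..N} - {..pmat_degree F}. pmat_coeff F n *v v (t - int n) = 0"
    proof
      fix n assume "n \<in> {..N} - {..pmat_degree F}"
      then have "coeff (F $ i $ j) n = 0" for i j
        using deg[of i j] by (intro coeff_eq_0) auto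
      then have "pmat_coeff F n = 0"
        by (simp add: pmat_coeff_def vec_eq_iff)
      then show "pmat_coeff F n *v v (t - int n) = 0"
        by simp
    qed
  qed (use le in auto)
qed

text \<open>With these definitions \<open>P[z]s = Q[z]e\<close> is the usual ARMA recursion.\<close>

lemma pmat_act_arma_iff:
  "pmat_act (ar_pmat p P) s t = pmat_act (ma_pmat q Q) e t \<longleftrightarrow>
   s t = (\<Sum>i = 1..p. P i *v s (t - int i)) + (\<Sum>j\<le>q. Q j *v e (t - int j))"
proof -
  have degP: "degree (ar_pmat p P $ i $ j) \<le> p" for i j
    by (auto simp: ar_pmat_def pmat_monom_def mat_def sum_component
        intro!: degree_diff_le degree_sum_le order.trans[OF degree_monom_le])
  have degQ: "degree (ma_pmat q Q $ i $ j) \<le> q" for i j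
    by (auto simp: ma_pmat_def pmat_monom_def sum_component
        intro!: degree_sum_le order.trans[OF degree_monom_le])
  have cP0: "pmat_coeff (ar_pmat p P) 0 = mat 1"
    by (simp add: pmat_coeff_def ar_pmat_def pmat_monom_def vec_eq_iff mat_def
        sum_component coeff_sum)
  have cP: "pmat_coeff (ar_pmat p P) n = - P n" if "n \<in> {1..p}" for n
    using that
    by (simp add: pmat_coeff_def ar_pmat_def pmat_monom_def vec_eq_iff mat_def
        sum_component coeff_sum sum.delta)
  have cQ: "pmat_coeff (ma_pmat q Q) n = Q n" if "n \<le> q" for n
    using that
    by (simp add: pmat_coeff_def ma_pmat_def pmat_monom_def vec_eq_iff
        sum_component coeff_sum sum.delta)
  have neg: "(- C) *v u = - (C *v u)" for C :: "real ^ 'a ^ 'a" and u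
    by (simp add: vec_eq_iff matrix_vector_mult_def sum_negf)
  have "pmat_act (ar_pmat p P) s t = s t - (\<Sum>i = 1..p. P i *v s (t - int i))"
  proof -
    have "{..p} = insert 0 {1..p}" by auto
    then have "pmat_act (ar_pmat p P) s t = pmat_coeff (ar_pmat p P) 0 *v s t
        + (\<Sum>i = 1..p. pmat_coeff (ar_pmat p P) i *v s (t - int i))"
      by (simp add: pmat_act_eq_sum[OF degP])
    also have "(\<Sum>i = 1..p. pmat_coeff (ar_pmat p P) i *v s (t - int i))
        = - (\<Sum>i = 1..p. P i *v s (t - int i))"
      unfolding sum_negf[symmetric] by (rule sum.cong) (simp_all only: cP neg)
    finally show ?thesis
      by (simp add: cP0)
  qed
  moreover have "pmat_act (ma_pmat q Q) e t = (\<Sum>j\<le>q. Q j *v e (t - int j))"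
    unfolding pmat_act_eq_sum[OF degQ] by (rule sum.cong) (simp_all add: cQ)
  ultimately show ?thesis
    by (auto simp: algebra_simps)
qed

definition iid_noise :: "'a measure \<Rightarrow> (int \<Rightarrow> 'a \<Rightarrow> real ^ 'n) \<Rightarrow> bool" where
  "iid_noise M e \<longleftrightarrow>
     prob_space.indep_vars M (\<lambda>_. borel) e UNIV \<and>
     (\<forall>t t'. distr M borel (e t) = distr M borel (e t')) \<and>
     (\<forall>t. integral\<^sup>L M (e t) = 0) \<and>
     (\<forall>t. integrable M (\<lambda>\<omega>. (norm (e t \<omega>))\<^sup>2))"

text \<open>The coordinates of an $\mathbb{R}^{D}$-valued process are grouped into blocks, \<open>blk i\<close> being
  the number of the block to which coordinate \<open>i\<close> belongs. Block \<open>m\<close> is, as a process, a single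
  random family of real numbers indexed by time and by the coordinates in that block. The order in
  which coordinates are stacked is immaterial, so none is imposed on the index type.\<close>

definition block_process ::
  "('n \<Rightarrow> nat) \<Rightarrow> (int \<Rightarrow> 'a \<Rightarrow> real ^ 'n) \<Rightarrow> nat \<Rightarrow> 'a \<Rightarrow> (int \<times> 'n \<Rightarrow> real)" where
  "block_process blk e m \<omega> = (\<lambda>(t, i)\<in>UNIV \<times> {i. blk i = m}. e t \<omega> $ i)"

definition independent_blocks ::
  "'a measure \<Rightarrow> nat \<Rightarrow> ('n \<Rightarrow> nat) \<Rightarrow> (int \<Rightarrow> 'a \<Rightarrow> real ^ 'n) \<Rightarrow> bool" where
  "independent_blocks M K blk e \<longleftrightarrow>
     prob_space.indep_vars M (\<lambda>m. PiM (UNIV \<times> {i. blk i = m}) (\<lambda>_. borel))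
       (block_process blk e) {..<K}"

text \<open>Strict stationarity: the law of the whole process is invariant under time shifts.\<close>

definition stationary_process :: "'a measure \<Rightarrow> (int \<Rightarrow> 'a \<Rightarrow> real ^ 'n) \<Rightarrow> bool" where
  "stationary_process M X \<longleftrightarrow>
     (\<forall>t. X t \<in> borel_measurable M) \<and>
     (\<forall>h. distr M (PiM UNIV (\<lambda>_. borel)) (\<lambda>\<omega> t. X (t + h) \<omega>)
        = distr M (PiM UNIV (\<lambda>_. borel)) (\<lambda>\<omega> t. X t \<omega>))"

definition past_sigma :: "'a measure \<Rightarrow> (int \<Rightarrow> 'a \<Rightarrow> real ^ 'n) \<Rightarrow> int \<Rightarrow> 'a measure" where
  "past_sigma M X t =
     sigma (space M) (\<Union>u\<in>{..<t}. {X u -` B \<inter> space M | B. B \<in> sets borel})"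

definition vec_cond_exp ::
  "'a measure \<Rightarrow> 'a measure \<Rightarrow> ('a \<Rightarrow> real ^ 'n) \<Rightarrow> 'a \<Rightarrow> real ^ 'n" where
  "vec_cond_exp M F f \<omega> = (\<chi> i. real_cond_exp M F (\<lambda>\<omega>. f \<omega> $ i) \<omega>)"

definition innovation ::
  "'a measure \<Rightarrow> (int \<Rightarrow> 'a \<Rightarrow> real ^ 'n) \<Rightarrow> int \<Rightarrow> 'a \<Rightarrow> real ^ 'n" where
  "innovation M X t \<omega> = X t \<omega> - vec_cond_exp M (past_sigma M X t) (X t) \<omega>"

definition autoregressive :: "'a measure \<Rightarrow> (int \<Rightarrow> 'a \<Rightarrow> real ^ 'n) \<Rightarrow> bool" where
  "autoregressive M X \<longleftrightarrow>
     (\<exists>(L::nat) F. \<forall>t. AE \<omega> in M.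
        X t \<omega> = (\<Sum>i = 1..L. F i *v X (t - int i) \<omega>) + innovation M X t \<omega>)"

end

theory Submission
  imports Defs "HOL-Complex_Analysis.Cauchy_Integral_Formula"
begin

text \<open>Let \<open>B\<close> be a left inverse of \<open>A\<close> and \<open>W[z]\<close> one of \<open>Q[z]\<close>. Then
  \<open>s = B x\<close> and \<open>e = W[z] Q[z] e = W[z] P[z] B x\<close>, so both \<open>s\<close> and \<open>e\<close> are obtained from \<open>x\<close> with
  finite memory and without looking ahead. Inserting this into all terms of the recursion for
  \<open>x = A s\<close> except \<open>A Q\<^sub>0 e(t)\<close> gives \<open>x(t)\<close> as a finite linear combination of \<open>x(t-1), x(t-2), \<dots>\<close>
  plus \<open>A Q\<^sub>0 e(t)\<close> (\<open>exists_ar_operator\<close>). This part is pure algebra, and it yields the operator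
  \<open>W_AR\<close> at the same time.

  It remains to see that \<open>A Q\<^sub>0 e(t)\<close> is the innovation, that is, that \<open>e(t)\<close> has conditional mean 0
  given the past of \<open>x\<close>. This holds because \<open>e(t)\<close> is independent of the past of \<open>e\<close>
  (\<open>integral_past_times_present\<close>), provided that the past of \<open>x\<close> is determined, up to null sets, by
  the past of \<open>e\<close> (\<open>innovation_eq\<close>). So the stationary solution \<open>s\<close> must be shown to be causal, and it
  must be shown to be integrable, since only its strict stationarity is given
  (\<open>stationary_arma_causal\<close>). The adjugate of \<open>P[z]\<close> reduces this to a scalar recursion
  \<open>det P[z] v = w\<close>. By stability, \<open>1 / det P[z]\<close> has absolutely summable Taylor coefficients
  (\<open>summable_inverse_poly\<close>); multiplying by its Taylor polynomials gives partial sums of a causal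
  series, with a remainder that consists of boundedly many values of \<open>v\<close> with coefficients that tend
  to 0. As these values all have the same law, the remainder tends to 0 in probability
  (\<open>stationary_solution_causal\<close>).\<close>

section \<open>Polynomials in the time shift\<close>

definition shift_act :: "real poly \<Rightarrow> (int \<Rightarrow> real) \<Rightarrow> int \<Rightarrow> real" where
  "shift_act f v t = (\<Sum>n\<le>degree f. coeff f n * v (t - int n))"

lemma shift_act_eq_sum:
  assumes "degree f \<le> N"
  shows "shift_act f v t = (\<Sum>n\<le>N. coeff f n * v (t - int n))"
  unfolding shift_act_def
  by (rule sum.mono_neutral_left) (use assms in \<open>auto simp: coeff_eq_0\<close>)

lemma shift_act_0 [simp]: "shift_act 0 v t = 0"
  by (simp add: shift_act_def)

lemma shift_act_1 [simp]: "shift_act 1 v t = v t"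
  by (simp add: shift_act_def)

lemma shift_act_add: "shift_act (f + g) v t = shift_act f v t + shift_act g v t"
proof -
  let ?N = "max (degree f) (degree g)"
  show ?thesis
    by (simp add: shift_act_eq_sum[of _ ?N] degree_add_le sum.distrib algebra_simps)
qed

lemma shift_act_diff: "shift_act (f - g) v t = shift_act f v t - shift_act g v t"
  using shift_act_add[of "f - g" g v t] by simp

lemma shift_act_smult: "shift_act (smult c f) v t = c * shift_act f v t"
  by (simp add: shift_act_eq_sum[of _ "degree f"] sum_distrib_left mult.assoc)

lemma shift_act_sum: "shift_act (sum f S) v t = (\<Sum>j\<in>S. shift_act (f j) v t)"
  by (induction S rule: infinite_finite_induct) (simp_all add: shift_act_add)

lemma shift_act_sum_arg: "shift_act f (\<lambda>u. \<Sum>j\<in>S. v j u) t = (\<Sum>j\<in>S. shift_act f (v j) t)"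
  by (simp add: shift_act_def sum_distrib_left sum.swap[of _ S])

lemma shift_act_pCons: "shift_act (pCons a f) v t = a * v t + shift_act f v (t - 1)"
proof -
  have "shift_act (pCons a f) v t = (\<Sum>n\<le>Suc (degree f). coeff (pCons a f) n * v (t - int n))"
    by (rule shift_act_eq_sum) (simp add: degree_pCons_le)
  also have "\<dots> = a * v t + shift_act f v (t - 1)"
    by (simp add: sum.atMost_Suc_shift shift_act_def algebra_simps del: sum.atMost_Suc)
  finally show ?thesis .
qed

text \<open>Polynomials act as a ring: this is what makes identities between polynomial matrices, such as
  \<open>W ** Q = mat 1\<close>, into identities between processes, sample path by sample path.\<close>

lemma shift_act_mult: "shift_act (f * g) v t = shift_act f (shift_act g v) t"
proof (induction f arbitrary: t)
  case (pCons a f)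
  then show ?case
    by (simp add: mult_pCons_left shift_act_add shift_act_smult shift_act_pCons)
qed simp

text \<open>Reduction to scalar operators, which do not refer to the common bound \<open>pmat_degree F\<close>.\<close>

lemma pmat_act_nth:
  "pmat_act F v t $ i = (\<Sum>j\<in>UNIV. shift_act (F $ i $ j) (\<lambda>u. v u $ j) t)"
proof -
  have deg: "degree (F $ i $ j) \<le> pmat_degree F" for j
    unfolding pmat_degree_def by (rule Max_ge) auto
  show ?thesis
    by (simp add: pmat_act_def shift_act_eq_sum[OF deg] sum_component matrix_vector_mult_def
        pmat_coeff_def sum.swap[of _ "{..pmat_degree F}"])
qed

lemma pmat_act_mult: "pmat_act (F ** G) v t = pmat_act F (pmat_act G v) t"
  by (simp add: vec_eq_iff pmat_act_nth matrix_matrix_mult_def shift_act_sum shift_act_sum_arg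
      shift_act_mult)
    (auto intro: sum.swap)

lemma pmat_act_diff: "pmat_act (F - G) v t = pmat_act F v t - pmat_act G v t"
  by (simp add: vec_eq_iff pmat_act_nth shift_act_diff sum_subtractf)

lemma pmat_act_mat: "pmat_act (mat f) v t $ i = shift_act f (\<lambda>u. v u $ i) t"
proof -
  have "pmat_act (mat f) v t $ i = (\<Sum>j\<in>UNIV. if i = j then shift_act f (\<lambda>u. v u $ j) t else 0)"
    unfolding pmat_act_nth by (rule sum.cong) (auto simp: mat_def)
  then show ?thesis by simp
qed

lemma pmat_act_one [simp]: "pmat_act (mat 1) v t = v t"
  by (simp add: vec_eq_iff pmat_act_mat)

lemma pmat_act_const [simp]: "pmat_act (pmat_monom C 0) v t = C *v v t"
  by (simp add: vec_eq_iff pmat_act_nth pmat_monom_def matrix_vector_mult_def shift_act_def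
      degree_monom_eq monom_0)

text \<open>Coefficients at 0 carry the causal structure: a polynomial matrix with vanishing coefficient at 0
  only looks at the strict past. They multiply because evaluation at 0 is a ring homomorphism.\<close>

lemma pmat_coeff_0_mult: "pmat_coeff (F ** G) 0 = pmat_coeff F 0 ** pmat_coeff G 0"
  by (simp add: pmat_coeff_def matrix_matrix_mult_def vec_eq_iff coeff_sum coeff_mult_0)

lemma pmat_coeff_diff: "pmat_coeff (F - G) n = pmat_coeff F n - pmat_coeff G n"
  by (simp add: pmat_coeff_def vec_eq_iff)

lemma pmat_coeff_const: "pmat_coeff (pmat_monom C 0) 0 = C"
  by (simp add: pmat_coeff_def pmat_monom_def vec_eq_iff)

section \<open>The adjugate over a commutative ring\<close>

text \<open>The cofactors are written as determinants of full size, with a row replaced by a unit vector,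
  which spares minors and signs.\<close>

definition adjugate :: "'a::comm_ring_1 ^ 'n ^ 'n \<Rightarrow> 'a ^ 'n ^ 'n" where
  "adjugate A = (\<chi> i j. det (\<chi> k. if k = j then axis i 1 else A $ k))"

text \<open>Expanding row \<open>m\<close> of the product by linearity of the determinant in row \<open>j\<close> puts row \<open>m\<close> of \<open>A\<close>
  into row \<open>j\<close>: the result is \<open>det A\<close> for \<open>m = j\<close>, and otherwise a determinant with two equal rows.
  The argument works over any commutative ring, in particular over the polynomials.\<close>

lemma mult_adjugate:
  fixes A :: "'a::comm_ring_1 ^ 'n ^ 'n"
  shows "A ** adjugate A = mat (det A)"
proof -
  have "(\<Sum>i\<in>UNIV. A $ m $ i * det (\<chi> k. if k = j then axis i 1 else A $ k))
      = (if m = j then det A else 0)" for m j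
  proof -
    have "(\<Sum>i\<in>UNIV. A $ m $ i * det (\<chi> k. if k = j then axis i 1 else A $ k))
        = (\<Sum>i\<in>UNIV. det (\<chi> k. if k = j then A $ m $ i *s axis i 1 else A $ k))"
      by (simp add: det_row_mul)
    also have "\<dots> = det (\<chi> k. if k = j then (\<Sum>i\<in>UNIV. A $ m $ i *s axis i 1) else A $ k)"
      by (simp add: det_linear_row_sum)
    also have "(\<Sum>i\<in>UNIV. A $ m $ i *s axis i 1) = A $ m"
      by (simp add: vec_eq_iff sum_component axis_def if_distrib[of "\<lambda>x. _ * x"] cong: if_cong)
    also have "det (\<chi> k. if k = j then A $ m else A $ k) = (if m = j then det A else 0)"
    proof (cases "m = j")
      case True
      then have "(\<chi> k. if k = j then A $ m else A $ k) = A" by (simp add: vec_eq_iff)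
      then show ?thesis using True by simp
    next
      case False
      then have "det (\<chi> k. if k = j then A $ m else A $ k) = 0"
        by (intro det_identical_rows[OF False]) (simp add: row_def vec_eq_iff)
      then show ?thesis using False by simp
    qed
    finally show ?thesis .
  qed
  then show ?thesis
    by (simp add: vec_eq_iff matrix_matrix_mult_def adjugate_def mat_def)
qed

lemma exists_left_adjugate:
  fixes A :: "'a::comm_ring_1 ^ 'n ^ 'n"
  shows "\<exists>B. B ** A = mat (det A)"
proof -
  have "transpose (transpose A ** adjugate (transpose A)) = transpose (mat (det A))"
    by (simp only: mult_adjugate det_transpose)
  then have "transpose (adjugate (transpose A)) ** A = mat (det A)"
    by (simp add: matrix_transpose_mul)
  then show ?thesis by blast
qed

section \<open>Absolutely summable inverses of stable polynomials\<close>

abbreviation ceval :: "complex \<Rightarrow> real poly \<Rightarrow> complex" where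
  "ceval z f \<equiv> poly (map_poly complex_of_real f) z"

lemma ceval_add: "ceval z (f + g) = ceval z f + ceval z g"
proof -
  have "map_poly complex_of_real (f + g) = map_poly of_real f + map_poly of_real g"
    by (rule poly_eqI) (simp add: coeff_map_poly)
  then show ?thesis by simp
qed

lemma ceval_smult: "ceval z (smult a f) = of_real a * ceval z f"
proof -
  have "map_poly complex_of_real (smult a f) = smult (of_real a) (map_poly of_real f)"
    by (rule poly_eqI) (simp add: coeff_map_poly)
  then show ?thesis by simp
qed

lemma ceval_pCons: "ceval z (pCons a f) = of_real a + z * ceval z f"
  by (cases "a = 0 \<and> f = 0") (auto simp: map_poly_pCons)

lemma ceval_mult: "ceval z (f * g) = ceval z f * ceval z g"
  by (induction f) (simp_all add: mult_pCons_left ceval_add ceval_smult ceval_pCons algebra_simps)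

lemma ceval_det: "ceval z (det F) = det (pmat_eval F z)"
proof -
  have sum: "ceval z (sum h S) = (\<Sum>x\<in>S. ceval z (h x))" for h :: "'b \<Rightarrow> real poly" and S
    by (induction S rule: infinite_finite_induct) (simp_all add: ceval_add)
  have prod: "ceval z (prod h S) = (\<Prod>x\<in>S. ceval z (h x))" for h :: "'b \<Rightarrow> real poly" and S
    by (induction S rule: infinite_finite_induct) (simp_all add: ceval_mult)
  have sgn: "ceval z (of_int (sign \<pi>)) = of_int (sign \<pi>)" for \<pi> :: "'b \<Rightarrow> 'b"
    using ceval_add[of 1 "-1" z] by (auto simp: sign_def add_eq_0_iff)
  show ?thesis
    by (simp add: det_def sum prod sgn ceval_mult pmat_eval_def)
qed

lemma exists_radius_gt_1_no_root:
  fixes f :: "complex poly"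
  assumes "\<And>z. norm z \<le> 1 \<Longrightarrow> poly f z \<noteq> 0"
  shows "\<exists>r>1. \<forall>z. norm z < r \<longrightarrow> poly f z \<noteq> 0"
proof -
  have "f \<noteq> 0" using assms[of 0] by auto
  then have fin: "finite {z. poly f z = 0}" by (rule poly_roots_finite)
  define S where "S = insert 2 (norm ` {z. poly f z = 0})"
  have S: "finite S" "S \<noteq> {}" using fin by (auto simp: S_def)
  have "Min S > 1"
    using S assms by (subst Min_gr_iff) (force simp: S_def not_le[symmetric])+
  moreover have "\<forall>z. norm z < Min S \<longrightarrow> poly f z \<noteq> 0"
    using S by (auto simp: S_def)
  ultimately show ?thesis by blast
qed

text \<open>The Taylor coefficients of \<open>1 / f\<close> at 0: since the finitely many roots of \<open>f\<close> lie outside the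
  closed unit disc, the series has radius of convergence greater than 1, so it converges absolutely
  at 1. Working with coefficients alone keeps the later argument free of complex numbers.\<close>

lemma summable_inverse_poly:
  fixes f :: "real poly"
  assumes nz: "\<And>z. norm z \<le> 1 \<Longrightarrow> ceval z f \<noteq> 0"
  obtains c :: "nat \<Rightarrow> real" where "summable (\<lambda>n. \<bar>c n\<bar>)"
    and "\<And>n. (\<Sum>k\<le>n. c k * coeff f (n - k)) = (if n = 0 then 1 else 0)"
proof -
  define F where "F = fps_of_poly (map_poly complex_of_real f)"
  obtain r where r: "r > 1" "\<And>z. norm z < r \<Longrightarrow> ceval z f \<noteq> 0"
    using exists_radius_gt_1_no_root[of "map_poly complex_of_real f"] nz by blast
  have rad: "fps_conv_radius (inverse F) \<ge> min (ereal r) (fps_conv_radius F)"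
    by (rule fps_conv_radius_inverse) (use r in \<open>simp add: F_def\<close>)
  have "ereal 1 < fps_conv_radius (inverse F)"
    using r rad by (simp add: F_def) (metis less_le_trans one_ereal_def less_ereal.simps(1))
  then have "summable (\<lambda>n. norm (fps_nth (inverse F) n * 1 ^ n))"
    by (intro norm_summable_fps) (simp add: one_ereal_def)
  then have sum1: "summable (\<lambda>n. norm (fps_nth (inverse F) n))" by simp
  have "fps_nth F 0 \<noteq> 0"
    using nz[of 0] by (simp add: F_def poly_0_coeff_0)
  then have inv: "inverse F * F = 1" by (rule inverse_mult_eq_1)
  define G where "G = inverse F"
  \<comment> \<open>The coefficients are in fact real, but taking real parts is enough, as those of \<open>f\<close> are real.\<close>
  show ?thesis
  proof (rule that[of "\<lambda>n. Re (fps_nth G n)"])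
    show "summable (\<lambda>n. \<bar>Re (fps_nth G n)\<bar>)"
      by (rule summable_comparison_test'[OF sum1, of 0]) (simp add: abs_Re_le_cmod G_def)
    fix n
    have "(\<Sum>k\<le>n. fps_nth G k * complex_of_real (coeff f (n - k))) = fps_nth (G * F) n"
      by (simp add: fps_mult_nth F_def coeff_map_poly atLeast0AtMost)
    also have "\<dots> = (if n = 0 then 1 else 0)"
      using inv by (simp add: G_def)
    finally have "Re (\<Sum>k\<le>n. fps_nth G k * complex_of_real (coeff f (n - k))) = Re (if n = 0 then 1 else 0)"
      by (rule arg_cong)
    then show "(\<Sum>k\<le>n. Re (fps_nth G k) * coeff f (n - k)) = (if n = 0 then 1 else 0)"
      by (simp split: if_splits)
  qed
qed

text \<open>If \<open>C\<^sub>n\<close> is the \<open>n\<close>-th Taylor polynomial of \<open>1 / f\<close>, then \<open>C\<^sub>n * f\<close> is 1 plus terms of the degrees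
  \<open>n + 1, \<dots>, n + degree f\<close> only. Each of their coefficients is a combination of the last few
  \<open>c k\<close> with fixed weights, hence tends to 0. Applied to a process, this isolates \<open>v t\<close> up to boundedly
  many small multiples of values in the remote past.\<close>

lemma truncated_inverse:
  fixes c :: "nat \<Rightarrow> real"
  assumes c0: "c \<longlonglongrightarrow> 0"
    and inv: "\<And>n. (\<Sum>k\<le>n. c k * coeff f (n - k)) = (if n = 0 then 1 else 0)"
  obtains r :: "nat \<Rightarrow> nat \<Rightarrow> real" where "\<And>j. (\<lambda>n. r n j) \<longlonglongrightarrow> 0"
    and "\<And>n v t. (\<Sum>k\<le>n. c k * shift_act f v (t - int k))
            = v t + (\<Sum>j<degree f. r n j * v (t - int (n + 1 + j)))"
proof -
  define C where "C n = (\<Sum>k\<le>n. monom (c k) k)" for n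
  define r where "r n j = coeff (C n * f) (n + 1 + j)" for n j
  have coeff_C: "coeff (C n) m = (if m \<le> n then c m else 0)" for n m
    by (simp add: C_def coeff_sum)
  have deg_C: "degree (C n) \<le> n" for n
    by (rule degree_le) (simp add: coeff_C)
  have act_C: "shift_act (C n) w t = (\<Sum>k\<le>n. c k * w (t - int k))" for n w t
    by (simp add: shift_act_eq_sum[OF deg_C] coeff_C)
  have r_eq: "r n j = (\<Sum>i\<le>n. c (n - i) * coeff f (1 + j + i))" for n j
  proof -
    have "r n j = (\<Sum>k\<le>n + 1 + j. coeff (C n) k * coeff f (n + 1 + j - k))"
      by (simp add: r_def coeff_mult)
    also have "\<dots> = (\<Sum>k\<le>n. c k * coeff f (n + 1 + j - k))"
      by (rule sum.mono_neutral_cong_right) (auto simp: coeff_C)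
    also have "\<dots> = (\<Sum>i\<le>n. c (n - i) * coeff f (n + 1 + j - (n - i)))"
      by (rule sum.reindex_bij_witness[of _ "\<lambda>i. n - i" "\<lambda>i. n - i"]) auto
    also have "\<dots> = (\<Sum>i\<le>n. c (n - i) * coeff f (1 + j + i))"
      by (rule sum.cong) (auto intro!: arg_cong[of _ _ "coeff f"])
    finally show ?thesis .
  qed
  show ?thesis
  proof (rule that[of r])
    fix j
    have "(\<lambda>n. c (n - i)) \<longlonglongrightarrow> 0" for i
      using c0 by (rule filterlim_compose) (rule filterlim_minus_const_nat_at_top)
    then have "(\<lambda>n. \<Sum>i\<le>degree f. c (n - i) * coeff f (1 + j + i)) \<longlonglongrightarrow>
        (\<Sum>i\<le>degree f. 0 * coeff f (1 + j + i))"
      by (intro tendsto_intros)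
    moreover have "\<forall>\<^sub>F n in sequentially.
        (\<Sum>i\<le>degree f. c (n - i) * coeff f (1 + j + i)) = r n j"
      using eventually_ge_at_top[of "degree f"]
    proof eventually_elim
      case (elim n)
      show ?case unfolding r_eq
        by (rule sum.mono_neutral_left) (use elim in \<open>auto simp: coeff_eq_0\<close>)
    qed
    ultimately show "(\<lambda>n. r n j) \<longlonglongrightarrow> 0"
      by (simp add: filterlim_cong[OF refl refl])
  next
    fix n v and t :: int
    have low: "coeff (C n * f) m = (if m = 0 then 1 else 0)" if "m \<le> n" for m
    proof -
      have "coeff (C n * f) m = (\<Sum>k\<le>m. c k * coeff f (m - k))"
        unfolding coeff_mult by (rule sum.cong) (use that in \<open>auto simp: coeff_C\<close>)
      then show ?thesis by (simp only: inv)
    qed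
    have "degree (C n * f) \<le> n + degree f"
      using degree_mult_le[of "C n" f] deg_C[of n] by linarith
    then have "shift_act (C n * f) v t = (\<Sum>m\<le>n + degree f. coeff (C n * f) m * v (t - int m))"
      by (rule shift_act_eq_sum)
    also have "{..n + degree f} = {..n} \<union> (\<lambda>j. n + 1 + j) ` {..<degree f}"
    proof -
      have "m \<in> (\<lambda>j. n + 1 + j) ` {..<degree f}" if "m \<le> n + degree f" "\<not> m \<le> n" for m
        by (rule image_eqI[of _ _ "m - (n + 1)"]) (use that in auto)
      then show ?thesis by auto
    qed
    also have "(\<Sum>m\<in>{..n} \<union> (\<lambda>j. n + 1 + j) ` {..<degree f}. coeff (C n * f) m * v (t - int m))
      = (\<Sum>m\<le>n. coeff (C n * f) m * v (t - int m)) + (\<Sum>j<degree f. r n j * v (t - int (n + 1 + j)))"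
      by (subst sum.union_disjoint) (auto simp: sum.reindex inj_on_def r_def)
    also have "(\<Sum>m\<le>n. coeff (C n * f) m * v (t - int m)) = (\<Sum>m\<le>n. if m = 0 then v t else 0)"
      by (rule sum.cong) (auto simp: low)
    finally show "(\<Sum>k\<le>n. c k * shift_act f v (t - int k))
            = v t + (\<Sum>j<degree f. r n j * v (t - int (n + 1 + j)))"
      by (simp add: shift_act_mult act_C)
  qed
qed

section \<open>Causality of stationary solutions of a scalar recursion\<close>

lemma AE_summable_abs:
  fixes g :: "nat \<Rightarrow> 'a \<Rightarrow> real"
  assumes int: "\<And>k. integrable M (g k)" and sum: "summable (\<lambda>k. \<integral>x. \<bar>g k x\<bar> \<partial>M)"
  shows "AE x in M. summable (\<lambda>k. \<bar>g k x\<bar>)"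
proof -
  have [measurable]: "g k \<in> borel_measurable M" for k using int[of k] by auto
  have "(\<integral>\<^sup>+x. (\<Sum>k. ennreal \<bar>g k x\<bar>) \<partial>M) = (\<Sum>k. \<integral>\<^sup>+x. ennreal \<bar>g k x\<bar> \<partial>M)"
    by (rule nn_integral_suminf) simp
  also have "\<dots> = (\<Sum>k. ennreal (\<integral>x. \<bar>g k x\<bar> \<partial>M))"
    by (intro suminf_cong nn_integral_eq_integral integrable_abs int) auto
  also have "\<dots> \<noteq> \<infinity>"
    using sum by (simp add: suminf_ennreal2)
  finally have "AE x in M. (\<Sum>k. ennreal \<bar>g k x\<bar>) \<noteq> \<infinity>"
    by (intro nn_integral_PInf_AE) auto
  then show ?thesis
    by eventually_elim (auto intro: summable_suminf_not_top)
qed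

context prob_space
begin

text \<open>Values with a common law, multiplied by factors that tend to 0, tend to 0 in probability, however
  the time indices move: a common law is tight. Convergence in probability is expressed by
  the bounded expectations \<open>E[min 1 \<bar>X\<bar>]\<close>, to which dominated convergence applies because the
  common law allows the random variable to be replaced by \<open>v 0\<close>.\<close>

lemma vanishing_combination_AE_subseq:
  fixes v :: "int \<Rightarrow> 'a \<Rightarrow> real" and r :: "nat \<Rightarrow> nat \<Rightarrow> real" and \<tau> :: "nat \<Rightarrow> nat \<Rightarrow> int"
  assumes [measurable]: "\<And>u. v u \<in> borel_measurable M"
    and law: "\<And>u. distr M borel (v u) = distr M borel (v 0)"
    and r: "\<And>j. (\<lambda>n. r n j) \<longlonglongrightarrow> 0"
  obtains \<phi> :: "nat \<Rightarrow> nat" where "strict_mono \<phi>"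
    and "AE \<omega> in M. (\<lambda>n. \<Sum>j<D. r (\<phi> n) j * v (\<tau> (\<phi> n) j) \<omega>) \<longlonglongrightarrow> 0"
proof -
  define R where "R n \<omega> = (\<Sum>j<D. r n j * v (\<tau> n j) \<omega>)" for n \<omega>
  have [measurable]: "R n \<in> borel_measurable M" for n
    unfolding R_def[abs_def] by measurable
  have int: "integrable M (\<lambda>\<omega>. min 1 \<bar>a * v u \<omega>\<bar>)" for a u
    by (rule integrable_const_bound[of _ 1]) auto
  have intR: "integrable M (\<lambda>\<omega>. min 1 \<bar>R n \<omega>\<bar>)" for n
    by (rule integrable_const_bound[of _ 1]) auto
  have same: "(\<integral>\<omega>. min 1 \<bar>a * v u \<omega>\<bar> \<partial>M) = (\<integral>\<omega>. min 1 \<bar>a * v 0 \<omega>\<bar> \<partial>M)" for a u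
  proof -
    have "(\<integral>\<omega>. min 1 \<bar>a * v u \<omega>\<bar> \<partial>M) = (\<integral>x. min 1 \<bar>a * x\<bar> \<partial>distr M borel (v u))"
      by (rule integral_distr[symmetric]) auto
    also have "\<dots> = (\<integral>\<omega>. min 1 \<bar>a * v 0 \<omega>\<bar> \<partial>M)"
      unfolding law[of u] by (rule integral_distr) auto
    finally show ?thesis .
  qed
  have lim: "(\<lambda>n. \<integral>\<omega>. min 1 \<bar>r n j * v 0 \<omega>\<bar> \<partial>M) \<longlonglongrightarrow> 0" for j
  proof -
    have "(\<lambda>n. \<integral>\<omega>. min 1 \<bar>r n j * v 0 \<omega>\<bar> \<partial>M) \<longlonglongrightarrow> (\<integral>\<omega>. min 1 \<bar>0 * v 0 \<omega>\<bar> \<partial>M)"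
    proof (rule integral_dominated_convergence[where w = "\<lambda>_. 1"])
      show "AE \<omega> in M. (\<lambda>n. min 1 \<bar>r n j * v 0 \<omega>\<bar>) \<longlonglongrightarrow> min 1 \<bar>0 * v 0 \<omega>\<bar>"
        by (intro AE_I2 tendsto_intros r)
    qed auto
    then show ?thesis by simp
  qed
  have sub: "min 1 \<bar>\<Sum>j\<in>J. h j\<bar> \<le> (\<Sum>j\<in>J. min 1 \<bar>h j\<bar>)" if "finite J" for J and h :: "nat \<Rightarrow> real"
    using that by induction (auto simp: min_def split: if_splits)
  have bound: "(\<integral>\<omega>. min 1 \<bar>R n \<omega>\<bar> \<partial>M) \<le> (\<Sum>j<D. \<integral>\<omega>. min 1 \<bar>r n j * v 0 \<omega>\<bar> \<partial>M)" for n
  proof -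
    have "(\<integral>\<omega>. min 1 \<bar>R n \<omega>\<bar> \<partial>M) \<le> (\<integral>\<omega>. (\<Sum>j<D. min 1 \<bar>r n j * v (\<tau> n j) \<omega>\<bar>) \<partial>M)"
      by (intro integral_mono intR Bochner_Integration.integrable_sum int) (simp add: R_def sub)
    also have "\<dots> = (\<Sum>j<D. \<integral>\<omega>. min 1 \<bar>r n j * v (\<tau> n j) \<omega>\<bar> \<partial>M)"
      by (intro Bochner_Integration.integral_sum int)
    also have "\<dots> = (\<Sum>j<D. \<integral>\<omega>. min 1 \<bar>r n j * v 0 \<omega>\<bar> \<partial>M)"
      by (intro sum.cong refl same)
    finally show ?thesis .
  qed
  have "(\<lambda>n. \<integral>\<omega>. norm (min 1 \<bar>R n \<omega>\<bar>) \<partial>M) \<longlonglongrightarrow> 0"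
  proof (rule tendsto_sandwich[OF _ _ tendsto_const])
    show "(\<lambda>n. \<Sum>j<D. \<integral>\<omega>. min 1 \<bar>r n j * v 0 \<omega>\<bar> \<partial>M) \<longlonglongrightarrow> 0"
      by (intro tendsto_null_sum lim)
  qed (use bound in \<open>auto intro!: always_eventually\<close>)
  from tendsto_L1_AE_subseq[OF intR this] obtain \<phi> where \<phi>: "strict_mono \<phi>"
    "AE \<omega> in M. (\<lambda>n. min 1 \<bar>R (\<phi> n) \<omega>\<bar>) \<longlonglongrightarrow> 0" by auto
  have "AE \<omega> in M. (\<lambda>n. R (\<phi> n) \<omega>) \<longlonglongrightarrow> 0"
    using \<phi>(2)
  proof eventually_elim
    case (elim \<omega>)
    then have "\<forall>\<^sub>F n in sequentially. min 1 \<bar>R (\<phi> n) \<omega>\<bar> < 1"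
      by (rule order_tendstoD) simp
    then have "\<forall>\<^sub>F n in sequentially. min 1 \<bar>R (\<phi> n) \<omega>\<bar> = \<bar>R (\<phi> n) \<omega>\<bar>"
      by eventually_elim (auto simp: min_def split: if_splits)
    then have "(\<lambda>n. \<bar>R (\<phi> n) \<omega>\<bar>) \<longlonglongrightarrow> 0"
      using elim by (simp add: filterlim_cong[OF refl refl])
    then show ?case by (simp add: tendsto_rabs_zero_iff)
  qed
  with \<phi>(1) show ?thesis by (intro that) (simp_all add: R_def)
qed

text \<open>Uniqueness of the stationary solution of a stable scalar recursion: the truncated inverse expresses
  \<open>v t\<close> by a partial sum of the causal series up to a remainder. The series converges almost surely
  by absolute summability in mean, and the remainder vanishes almost surely along a subsequence, so
  \<open>v t\<close> is the sum of the series and inherits its integrability.\<close>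

lemma stationary_solution_causal:
  fixes v w :: "int \<Rightarrow> 'a \<Rightarrow> real"
  assumes meas: "\<And>u. v u \<in> borel_measurable M"
    and law: "\<And>u. distr M borel (v u) = distr M borel (v 0)"
    and w: "\<And>u. integrable M (w u)" "\<And>u. (\<integral>\<omega>. \<bar>w u \<omega>\<bar> \<partial>M) \<le> B"
    and c: "summable (\<lambda>n. \<bar>c n\<bar>)"
    and inv: "\<And>n. (\<Sum>k\<le>n. c k * coeff f (n - k)) = (if n = 0 then 1 else 0)"
    and eq: "AE \<omega> in M. \<forall>u. shift_act f (\<lambda>u. v u \<omega>) u = w u \<omega>"
  shows "AE \<omega> in M. v t \<omega> = (\<Sum>k. c k * w (t - int k) \<omega>)"
    and "integrable M (v t)"
proof -
  let ?g = "\<lambda>k \<omega>. c k * w (t - int k) \<omega>"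
  have c0: "c \<longlonglongrightarrow> 0"
    using summable_LIMSEQ_zero[OF c] by (simp add: tendsto_rabs_zero_iff)
  obtain r where r: "\<And>j. (\<lambda>n. r n j) \<longlonglongrightarrow> 0"
    and trunc: "\<And>n h u. (\<Sum>k\<le>n. c k * shift_act f h (u - int k))
            = h u + (\<Sum>j<degree f. r n j * h (u - int (n + 1 + j)))"
    using truncated_inverse[OF c0 inv] by blast
  obtain \<phi> where \<phi>: "strict_mono \<phi>" "AE \<omega> in M.
      (\<lambda>n. \<Sum>j<degree f. r (\<phi> n) j * v (t - int (\<phi> n + 1 + j)) \<omega>) \<longlonglongrightarrow> 0"
    by (rule vanishing_combination_AE_subseq[where v = v and r = r and D = "degree f"
        and \<tau> = "\<lambda>n j. t - int (n + 1 + j)", OF meas law r])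
  have g: "integrable M (?g k)" for k
    using w(1) by simp
  have sum: "summable (\<lambda>k. \<integral>\<omega>. \<bar>?g k \<omega>\<bar> \<partial>M)"
  proof (rule summable_comparison_test'[where N = 0])
    show "summable (\<lambda>k. \<bar>c k\<bar> * B)" using c by (rule summable_mult2)
    show "norm (\<integral>\<omega>. \<bar>?g k \<omega>\<bar> \<partial>M) \<le> \<bar>c k\<bar> * B" for k
      using w(2)[of "t - int k"] by (simp add: abs_mult mult_left_mono)
  qed
  have ae: "AE \<omega> in M. summable (\<lambda>k. \<bar>?g k \<omega>\<bar>)"
    by (rule AE_summable_abs[OF g sum])
  show *: "AE \<omega> in M. v t \<omega> = (\<Sum>k. ?g k \<omega>)"
    using ae \<phi>(2) eq
  proof eventually_elim
    case (elim \<omega>)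
    have "(\<lambda>n. \<Sum>k\<le>n. ?g k \<omega>) \<longlonglongrightarrow> (\<Sum>k. ?g k \<omega>)"
      using summable_LIMSEQ'[OF summable_rabs_cancel[OF elim(1)]] .
    then have "(\<lambda>n. \<Sum>k\<le>\<phi> n. ?g k \<omega>) \<longlonglongrightarrow> (\<Sum>k. ?g k \<omega>)"
      using LIMSEQ_subseq_LIMSEQ[OF _ \<phi>(1)] by (auto simp: o_def)
    moreover have "(\<Sum>k\<le>n. ?g k \<omega>) = v t \<omega> + (\<Sum>j<degree f. r n j * v (t - int (n + 1 + j)) \<omega>)" for n
    proof -
      have "(\<Sum>k\<le>n. c k * shift_act f (\<lambda>u. v u \<omega>) (t - int k))
          = v t \<omega> + (\<Sum>j<degree f. r n j * v (t - int (n + 1 + j)) \<omega>)"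
        by (rule trunc)
      then show ?thesis using elim(3) by simp
    qed
    ultimately have "(\<lambda>n. v t \<omega> + (\<Sum>j<degree f. r (\<phi> n) j * v (t - int (\<phi> n + 1 + j)) \<omega>))
        \<longlonglongrightarrow> (\<Sum>k. ?g k \<omega>)" by simp
    moreover have "(\<lambda>n. v t \<omega> + (\<Sum>j<degree f. r (\<phi> n) j * v (t - int (\<phi> n + 1 + j)) \<omega>))
        \<longlonglongrightarrow> v t \<omega> + 0"
      by (intro tendsto_intros elim(2))
    ultimately show ?case
      using LIMSEQ_unique by fastforce
  qed
  have "integrable M (\<lambda>\<omega>. \<Sum>k. ?g k \<omega>)"
    by (rule integrable_suminf[OF g]) (use ae sum in simp_all)
  moreover have "(\<lambda>\<omega>. \<Sum>k. ?g k \<omega>) \<in> borel_measurable M"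
    using calculation by auto
  ultimately show "integrable M (v t)"
    using * meas by (subst integrable_cong_AE) auto
qed

end

section \<open>Generated pasts and independence\<close>

lemma borel_measurable_vec_iff:
  fixes f :: "'a \<Rightarrow> real ^ 'n"
  shows "f \<in> borel_measurable N \<longleftrightarrow> (\<forall>i. (\<lambda>\<omega>. f \<omega> $ i) \<in> borel_measurable N)"
  by (auto simp: borel_measurable_euclidean_space[of f] Basis_vec_def inner_axis)

lemma space_past_sigma [simp]: "space (past_sigma M X t) = space M"
  unfolding past_sigma_def by (rule space_measure_of) auto

lemma sets_past_sigma:
  "sets (past_sigma M X t)
    = sigma_sets (space M) (\<Union>u\<in>{..<t}. {X u -` B \<inter> space M | B. B \<in> sets borel})"
  unfolding past_sigma_def by (rule sets_measure_of) auto

lemma subalgebra_past_sigma: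
  assumes "\<And>u. X u \<in> borel_measurable M"
  shows "subalgebra M (past_sigma M X t)"
proof -
  have "(\<Union>u\<in>{..<t}. {X u -` B \<inter> space M | B. B \<in> sets borel}) \<subseteq> sets M"
    using measurable_sets[OF assms] by blast
  then show ?thesis
    unfolding subalgebra_def sets_past_sigma by (simp add: sets.sigma_sets_subset)
qed

lemma measurable_past_sigma:
  assumes "u < t"
  shows "X u \<in> borel_measurable (past_sigma M X t)"
  by (rule measurableI) (use assms in \<open>auto simp: sets_past_sigma intro!: sigma_sets.Basic\<close>)

text \<open>Almost sure versions generate the same past up to null sets. The past of \<open>X\<close> itself need not be
  contained in \<open>G\<close>, since \<open>G\<close> is not assumed to contain the null sets.\<close>

lemma past_sigma_AE_approximation:
  assumes sub: "subalgebra M G"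
    and X: "\<And>u. u < t \<Longrightarrow> \<exists>Y\<in>borel_measurable G. AE \<omega> in M. X u \<omega> = Y \<omega>"
    and A: "A \<in> sets (past_sigma M X t)"
  shows "\<exists>A'\<in>sets G. AE \<omega> in M. \<omega> \<in> A \<longleftrightarrow> \<omega> \<in> A'"
  using A unfolding sets_past_sigma
proof induction
  case (Basic A)
  then obtain u B where u: "u < t" "A = X u -` B \<inter> space M" "B \<in> sets borel" by auto
  obtain Y where Y: "Y \<in> borel_measurable G" "AE \<omega> in M. X u \<omega> = Y \<omega>"
    using X[OF u(1)] by blast
  have "Y -` B \<inter> space M \<in> sets G"
    using measurable_sets[OF Y(1) u(3)] sub by (simp add: subalgebra_def)
  moreover have "AE \<omega> in M. \<omega> \<in> A \<longleftrightarrow> \<omega> \<in> Y -` B \<inter> space M"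
    using Y(2) by eventually_elim (simp add: u)
  ultimately show ?case by blast
next
  case Empty
  show ?case by (rule bexI[of _ "{}"]) auto
next
  case (Compl A)
  then obtain A' where A': "A' \<in> sets G" "AE \<omega> in M. \<omega> \<in> A \<longleftrightarrow> \<omega> \<in> A'" by blast
  have "space M - A' \<in> sets G"
    using A'(1) sub sets.compl_sets by (fastforce simp: subalgebra_def)
  moreover have "AE \<omega> in M. \<omega> \<in> space M - A \<longleftrightarrow> \<omega> \<in> space M - A'"
    using A'(2) by eventually_elim auto
  ultimately show ?case by blast
next
  case (Union A)
  then have "\<forall>i. \<exists>A'. A' \<in> sets G \<and> (AE \<omega> in M. \<omega> \<in> A i \<longleftrightarrow> \<omega> \<in> A')" by blast
  then obtain A' where A': "\<And>i::nat. A' i \<in> sets G"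
    "\<And>i. AE \<omega> in M. \<omega> \<in> A i \<longleftrightarrow> \<omega> \<in> A' i" by metis
  have "AE \<omega> in M. \<forall>i. \<omega> \<in> A i \<longleftrightarrow> \<omega> \<in> A' i"
    using A'(2) by (simp add: AE_all_countable)
  then have "AE \<omega> in M. \<omega> \<in> (\<Union>i. A i) \<longleftrightarrow> \<omega> \<in> (\<Union>i. A' i)"
    by eventually_elim auto
  then show ?case using A'(1) by (intro bexI[of _ "\<Union>i. A' i"]) auto
qed

context prob_space
begin

text \<open>The past and the present of an independent sequence are independent, by the grouping of
  independent families that are stable under intersection over the disjoint index sets \<open>{..<t}\<close> and \<open>{t}\<close>.\<close>

lemma integral_past_times_present:
  fixes e :: "int \<Rightarrow> 'a \<Rightarrow> real ^ 'n" and g :: "real ^ 'n \<Rightarrow> real"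
  assumes indep: "indep_vars (\<lambda>_. borel) e UNIV"
    and A: "A \<in> sets (past_sigma M e t)"
    and g[measurable]: "g \<in> borel_measurable borel"
    and int: "integrable M (\<lambda>\<omega>. g (e t \<omega>))"
  shows "(\<integral>\<omega>. indicator A \<omega> * g (e t \<omega>) \<partial>M) = prob A * (\<integral>\<omega>. g (e t \<omega>) \<partial>M)"
proof -
  let ?E = "\<lambda>u. {e u -` B \<inter> space M | B. B \<in> sets borel}"
  let ?I = "case_bool {..<t} {t}"
  have e[measurable]: "e u \<in> borel_measurable M" for u
    using indep by (simp add: indep_vars_def2)
  have "indep_sets (\<lambda>j. sigma_sets (space M) (\<Union>u\<in>?I j. ?E u)) UNIV"
  proof (rule indep_sets_collect_sigma)
    show "indep_sets ?E (\<Union>j\<in>UNIV. ?I j)"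
      using indep unfolding indep_vars_def2 by (auto intro: indep_sets_mono_index[rotated])
    show "Int_stable (?E i)" for i
    proof (rule Int_stableI)
      fix a b assume "a \<in> ?E i" "b \<in> ?E i"
      then obtain B C where "a = e i -` B \<inter> space M" "b = e i -` C \<inter> space M"
        "B \<in> sets borel" "C \<in> sets borel" by blast
      then have "a \<inter> b = e i -` (B \<inter> C) \<inter> space M" "B \<inter> C \<in> sets borel" by auto
      then show "a \<inter> b \<in> ?E i" by blast
    qed
    show "disjoint_family_on ?I UNIV"
      by (auto simp: disjoint_family_on_def split: bool.splits)
  qed
  moreover have "(\<lambda>j. sigma_sets (space M) (\<Union>u\<in>?I j. ?E u))
      = case_bool (sets (past_sigma M e t)) (sigma_sets (space M) (?E t))"
    by (rule ext) (auto simp: sets_past_sigma split: bool.split)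
  ultimately have *: "indep_set (sets (past_sigma M e t)) (sigma_sets (space M) (?E t))"
    unfolding indep_set_def by simp
  have A_M: "A \<in> events"
    using A subalgebra_past_sigma[where X = e and t = t, OF e] by (auto simp: subalgebra_def)
  have "indep_var borel (indicator A :: 'a \<Rightarrow> real) borel (\<lambda>\<omega>. g (e t \<omega>))"
    unfolding indep_var_eq
  proof (intro conjI)
    show "random_variable borel (indicator A :: 'a \<Rightarrow> real)" using A_M by simp
    show "random_variable borel (\<lambda>\<omega>. g (e t \<omega>))" by measurable
    have "sigma_sets (space M) {(indicator A :: 'a \<Rightarrow> real) -` B \<inter> space M |B. B \<in> sets borel}
        \<subseteq> sets (past_sigma M e t)"
    proof -
      have ind: "(indicator A :: 'a \<Rightarrow> real) \<in> borel_measurable (past_sigma M e t)"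
        using A by simp
      have "(indicator A :: 'a \<Rightarrow> real) -` B \<inter> space M \<in> sets (past_sigma M e t)"
        if "B \<in> sets borel" for B
        using measurable_sets[OF ind that] by simp
      then have "{(indicator A :: 'a \<Rightarrow> real) -` B \<inter> space M |B. B \<in> sets borel}
          \<subseteq> sets (past_sigma M e t)" by blast
      from sets.sigma_sets_subset[OF this] show ?thesis by simp
    qed
    moreover have "sigma_sets (space M) {(\<lambda>\<omega>. g (e t \<omega>)) -` B \<inter> space M |B. B \<in> sets borel}
        \<subseteq> sigma_sets (space M) (?E t)"
    proof (rule sigma_sets_mono, safe)
      fix B :: "real set" assume "B \<in> sets borel"
      then have "g -` B \<in> sets borel" using measurable_sets[OF g] by simp
      then show "(\<lambda>\<omega>. g (e t \<omega>)) -` B \<inter> space M \<in> sigma_sets (space M) (?E t)"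
        by (intro sigma_sets.Basic) (auto simp: vimage_def)
    qed
    ultimately show "indep_set
      (sigma_sets (space M) {(indicator A :: 'a \<Rightarrow> real) -` B \<inter> space M |B. B \<in> sets borel})
      (sigma_sets (space M) {(\<lambda>\<omega>. g (e t \<omega>)) -` B \<inter> space M |B. B \<in> sets borel})"
      using * unfolding indep_sets2_eq by blast
  qed
  then have "(\<integral>\<omega>. indicator A \<omega> * g (e t \<omega>) \<partial>M)
      = (\<integral>\<omega>. indicator A \<omega> \<partial>M) * (\<integral>\<omega>. g (e t \<omega>) \<partial>M)"
    by (rule indep_var_lebesgue_integral) (use A_M int in \<open>auto simp: emeasure_eq_measure\<close>)
  then show ?thesis using A_M by simp
qed

lemma iid_noise_component:
  fixes e :: "int \<Rightarrow> 'a \<Rightarrow> real ^ 'n"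
  assumes "iid_noise M e"
  shows "integrable M (\<lambda>\<omega>. e t \<omega> $ i)"
    and "(\<integral>\<omega>. e t \<omega> $ i \<partial>M) = 0"
    and "(\<integral>\<omega>. \<bar>e t \<omega> $ i\<bar> \<partial>M) = (\<integral>\<omega>. \<bar>e 0 \<omega> $ i\<bar> \<partial>M)"
proof -
  have e[measurable]: "e u \<in> borel_measurable M" for u
    using assms by (simp add: iid_noise_def indep_vars_def2)
  have "integrable M (e t)"
  proof (rule Bochner_Integration.integrable_bound)
    show "integrable M (\<lambda>\<omega>. 1 + (norm (e t \<omega>))\<^sup>2)"
      using assms by (auto simp: iid_noise_def)
    have *: "norm v \<le> 1 + (norm v)\<^sup>2" for v :: "real ^ 'n"
    proof -
      have "2 * norm v \<le> (norm v)\<^sup>2 + 1"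
        using zero_le_power2[of "norm v - 1"] by (simp add: power2_diff)
      then show ?thesis using norm_ge_zero[of v] by linarith
    qed
    then show "AE \<omega> in M. norm (e t \<omega>) \<le> norm (1 + (norm (e t \<omega>))\<^sup>2)"
      by (auto simp: abs_of_nonneg intro!: AE_I2 *)
  qed measurable
  then show "integrable M (\<lambda>\<omega>. e t \<omega> $ i)"
    by (rule integrable_bounded_linear[OF bounded_linear_vec_nth])
  have "(\<integral>\<omega>. e t \<omega> $ i \<partial>M) = (\<integral>\<omega>. e t \<omega> \<partial>M) $ i"
    by (rule integral_bounded_linear[OF bounded_linear_vec_nth]) fact
  then show "(\<integral>\<omega>. e t \<omega> $ i \<partial>M) = 0"
    using assms by (simp add: iid_noise_def)
  have nth[measurable]: "(\<lambda>v :: real ^ 'n. v $ i) \<in> borel_measurable borel"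
    by (intro borel_measurable_continuous_onI continuous_intros)
  have "(\<integral>\<omega>. \<bar>e u \<omega> $ i\<bar> \<partial>M) = (\<integral>v. \<bar>v $ i\<bar> \<partial>distr M borel (e u))" for u
    by (rule integral_distr[symmetric]) auto
  moreover have "distr M borel (e t) = distr M borel (e 0)"
    using assms unfolding iid_noise_def by blast
  ultimately show "(\<integral>\<omega>. \<bar>e t \<omega> $ i\<bar> \<partial>M) = (\<integral>\<omega>. \<bar>e 0 \<omega> $ i\<bar> \<partial>M)"
    by simp
qed

end

lemma stationary_process_component_law:
  assumes "stationary_process M X"
  shows "distr M borel (\<lambda>\<omega>. X u \<omega> $ i) = distr M borel (\<lambda>\<omega>. X 0 \<omega> $ i)"
proof -
  have X[measurable]: "X t \<in> borel_measurable M" for t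
    using assms by (simp add: stationary_process_def)
  have nth: "(\<lambda>v :: real ^ 'b. v $ i) \<in> borel_measurable borel"
    by (intro borel_measurable_continuous_onI continuous_intros)
  have ev: "(\<lambda>p. p 0 $ i) \<in> borel_measurable (PiM (UNIV :: int set) (\<lambda>_. borel :: (real ^ 'b) measure))"
    by (rule measurable_compose[OF _ nth]) (rule measurable_component_singleton, simp)
  have path: "(\<lambda>\<omega> t. X (t + h) \<omega>) \<in> measurable M (PiM UNIV (\<lambda>_. borel))" for h
    by (rule measurable_PiM_single') auto
  have "distr M borel (\<lambda>\<omega>. X h \<omega> $ i)
      = distr (distr M (PiM UNIV (\<lambda>_. borel)) (\<lambda>\<omega> t. X (t + h) \<omega>)) borel (\<lambda>p. p 0 $ i)" for h
    by (subst distr_distr[OF ev path]) (simp add: o_def)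
  moreover have "distr M (PiM UNIV (\<lambda>_. borel)) (\<lambda>\<omega> t. X (t + u) \<omega>)
      = distr M (PiM UNIV (\<lambda>_. borel)) (\<lambda>\<omega> t. X (t + 0) \<omega>)"
    using assms unfolding stationary_process_def by simp
  ultimately show ?thesis by metis
qed

section \<open>The autoregressive operator\<close>

lemma pmat_coeff_ar_pmat_0: "pmat_coeff (ar_pmat p P) 0 = mat 1"
  by (simp add: pmat_coeff_def ar_pmat_def pmat_monom_def vec_eq_iff mat_def
      sum_component coeff_sum)

lemma pmat_coeff_ma_pmat_0: "pmat_coeff (ma_pmat q Q) 0 = Q 0"
  by (simp add: pmat_coeff_def ma_pmat_def pmat_monom_def vec_eq_iff
      sum_component coeff_sum sum.delta)

lemma pmat_coeff_mat_1_0: "pmat_coeff (mat 1) 0 = mat 1"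
  by (simp add: pmat_coeff_def vec_eq_iff mat_def)

text \<open>The finite autoregression. Along a path, \<open>B\<close> recovers \<open>s\<close> from \<open>x\<close> and \<open>W\<close> recovers \<open>e\<close> from
  \<open>P[z]s = Q[z]e\<close>, both with finite memory. In \<open>x t\<close> the term with \<open>P[z] - I\<close> and the terms
  \<open>Q\<^sub>j e(t-j)\<close> with \<open>j > 0\<close> can therefore be rewritten in terms of the strict past of \<open>x\<close>; what remains
  is \<open>A Q\<^sub>0 e(t)\<close>. In one formula, \<open>V = I - A (I - P[z]) B - A (Q[z] - Q\<^sub>0) W[z] P[z] B\<close>, where the
  factors \<open>I - P[z]\<close> and \<open>Q[z] - Q\<^sub>0\<close> have no term of degree 0.\<close>

lemma exists_ar_operator:
  fixes A :: "real ^ 's ^ 'x" and P :: "nat \<Rightarrow> real ^ 's ^ 's" and Q :: "nat \<Rightarrow> real ^ 'e ^ 's"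
  assumes B: "B ** A = mat 1" and W: "W ** ma_pmat q Q = mat 1"
  obtains V :: "real poly ^ 'x ^ 'x" where "pmat_coeff V 0 = mat 1"
    and "\<And>x s e t. (\<And>u. x u = A *v s u)
        \<Longrightarrow> (\<And>u. pmat_act (ar_pmat p P) s u = pmat_act (ma_pmat q Q) e u)
        \<Longrightarrow> pmat_act V x t = (A ** Q 0) *v e t"
proof -
  let ?P = "ar_pmat p P" and ?Q = "ma_pmat q Q"
  let ?A = "pmat_monom A 0" and ?B = "pmat_monom B 0" and ?QC = "pmat_monom (Q 0) 0"
  define V where "V = mat 1 - ?A ** ((mat 1 - ?P) ** ?B) - ?A ** ((?Q - ?QC) ** (W ** (?P ** ?B)))"
  show ?thesis
  proof (rule that[of V])
    have zero: "0 ** F = 0" "G ** 0 = 0" for F :: "real ^ 'a ^ 'b" and G :: "real ^ 'b ^ 'c"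
      by (simp_all add: vec_eq_iff matrix_matrix_mult_def)
    show "pmat_coeff V 0 = mat 1"
      by (simp add: V_def pmat_coeff_diff pmat_coeff_0_mult pmat_coeff_ar_pmat_0
          pmat_coeff_ma_pmat_0 pmat_coeff_mat_1_0 pmat_coeff_const zero)
  next
    fix x s e and t :: int
    assume x: "\<And>u. x u = A *v s u" and s: "\<And>u. pmat_act ?P s u = pmat_act ?Q e u"
    have mult: "pmat_act (F ** G) v = pmat_act F (pmat_act G v)"
      for F :: "real poly ^ 'i ^ 'j" and G :: "real poly ^ 'k ^ 'i" and v
      by (rule ext) (rule pmat_act_mult)
    have Bx: "pmat_act ?B x = s"
      by (rule ext) (simp add: x matrix_vector_mul_assoc B)
    have Ps: "pmat_act ?P s = pmat_act ?Q e" using s by blast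
    have We: "pmat_act W (pmat_act ?Q e) = e"
      by (rule ext) (simp add: W flip: pmat_act_mult)
    have "pmat_act V x t = x t - A *v (s t - pmat_act ?Q e t) - A *v (pmat_act ?Q e t - Q 0 *v e t)"
      by (simp only: V_def pmat_act_diff mult Bx Ps We pmat_act_one pmat_act_const)
    also have "\<dots> = (A ** Q 0) *v e t"
      by (simp add: x matrix_vector_mult_diff_distrib matrix_vector_mul_assoc)
    finally show "pmat_act V x t = (A ** Q 0) *v e t" .
  qed
qed

section \<open>Causality and innovations\<close>

text \<open>Multiplying \<open>F[z]s = G[z]e\<close> by the adjugate of \<open>F\<close> decouples the coordinates: each coordinate of
  \<open>s\<close> solves a scalar recursion with the polynomial \<open>det F\<close>, driven by a finite moving average of the
  noise. Scalar causality then makes \<open>s u\<close> a function of the noise up to time \<open>u\<close>.\<close>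

lemma (in prob_space) stationary_arma_causal:
  fixes s :: "int \<Rightarrow> 'a \<Rightarrow> real ^ 's" and e :: "int \<Rightarrow> 'a \<Rightarrow> real ^ 'e"
  assumes e: "iid_noise M e" and F: "pmat_stable F" and s: "stationary_process M s"
    and eq: "AE \<omega> in M. \<forall>u. pmat_act F (\<lambda>u. s u \<omega>) u = pmat_act G (\<lambda>u. e u \<omega>) u"
  shows "integrable M (\<lambda>\<omega>. s u \<omega> $ i)"
    and "u < t \<Longrightarrow> \<exists>Y\<in>borel_measurable (past_sigma M e t). AE \<omega> in M. s u \<omega> = Y \<omega>"
proof -
  obtain H where H: "H ** F = mat (det F)" using exists_left_adjugate by blast
  define N where "N = H ** G"
  define w where "w i u \<omega> = pmat_act N (\<lambda>u. e u \<omega>) u $ i" for i u \<omega>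
  have w_eq: "w i u \<omega> = (\<Sum>j\<in>UNIV. \<Sum>n\<le>degree (N $ i $ j). coeff (N $ i $ j) n * e (u - int n) \<omega> $ j)"
    for i u \<omega> by (simp add: w_def pmat_act_nth shift_act_def)
  have scalar: "AE \<omega> in M. \<forall>u. shift_act (det F) (\<lambda>u. s u \<omega> $ i) u = w i u \<omega>" for i
    using eq
  proof eventually_elim
    case (elim \<omega>)
    then have act: "pmat_act F (\<lambda>u. s u \<omega>) = pmat_act G (\<lambda>u. e u \<omega>)" by blast
    have "shift_act (det F) (\<lambda>u. s u \<omega> $ i) u = pmat_act (H ** F) (\<lambda>u. s u \<omega>) u $ i" for u
      unfolding H by (simp only: pmat_act_mat)
    also have "pmat_act (H ** F) (\<lambda>u. s u \<omega>) u $ i = w i u \<omega>" for u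
      by (simp only: pmat_act_mult act N_def w_def)
    finally show ?case by blast
  qed
  have "ceval z (det F) \<noteq> 0" if "norm z \<le> 1" for z
    using F that by (simp add: ceval_det pmat_stable_def)
  then obtain c where c: "summable (\<lambda>n. \<bar>c n\<bar>)"
    and inv: "\<And>n. (\<Sum>k\<le>n. c k * coeff (det F) (n - k)) = (if n = 0 then 1 else 0)"
    using summable_inverse_poly[of "det F"] by blast
  have s_meas: "(\<lambda>\<omega>. s u \<omega> $ i) \<in> borel_measurable M" for u i
    using s borel_measurable_vec_iff by (auto simp: stationary_process_def)
  have w_int: "integrable M (w i u)" for i u
    unfolding w_eq[abs_def]
    by (intro Bochner_Integration.integrable_sum integrable_mult_right iid_noise_component e)
  \<comment> \<open>A bound in mean for the driving moving average, uniform in time because the noise is identically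
    distributed.\<close>
  define C where "C i = (\<Sum>j\<in>UNIV. \<Sum>n\<le>degree (N $ i $ j).
      \<bar>coeff (N $ i $ j) n\<bar> * (\<integral>\<omega>. \<bar>e 0 \<omega> $ j\<bar> \<partial>M))" for i
  have w_bound: "(\<integral>\<omega>. \<bar>w i u \<omega>\<bar> \<partial>M) \<le> C i" for i u
  proof -
    have "(\<integral>\<omega>. \<bar>w i u \<omega>\<bar> \<partial>M) \<le> (\<integral>\<omega>. (\<Sum>j\<in>UNIV. \<Sum>n\<le>degree (N $ i $ j).
        \<bar>coeff (N $ i $ j) n\<bar> * \<bar>e (u - int n) \<omega> $ j\<bar>) \<partial>M)"
    proof (intro integral_mono integrable_abs w_int Bochner_Integration.integrable_sum
        integrable_mult_right iid_noise_component e)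
      fix \<omega>
      show "\<bar>w i u \<omega>\<bar> \<le> (\<Sum>j\<in>UNIV. \<Sum>n\<le>degree (N $ i $ j).
          \<bar>coeff (N $ i $ j) n\<bar> * \<bar>e (u - int n) \<omega> $ j\<bar>)"
        unfolding w_eq abs_mult[symmetric]
        by (intro order.trans[OF sum_abs] sum_mono order.refl)
    qed
    also have "\<dots> = (\<Sum>j\<in>UNIV. \<Sum>n\<le>degree (N $ i $ j).
        \<bar>coeff (N $ i $ j) n\<bar> * (\<integral>\<omega>. \<bar>e (u - int n) \<omega> $ j\<bar> \<partial>M))"
      by (simp add: Bochner_Integration.integral_sum Bochner_Integration.integrable_sum
          integrable_mult_right integrable_abs iid_noise_component(1)[OF e])
    also have "\<dots> = C i"
      unfolding C_def by (intro sum.cong refl arg_cong2[of _ _ _ _ "(*)"] iid_noise_component(3) e)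
    finally show ?thesis .
  qed
  note causal = stationary_solution_causal[where v = "\<lambda>u \<omega>. s u \<omega> $ i" and w = "w i" and B = "C i"
      and f = "det F" for i, OF s_meas stationary_process_component_law[OF s] w_int w_bound c inv scalar]
  show "integrable M (\<lambda>\<omega>. s u \<omega> $ i)" by (rule causal(2))
  show "\<exists>Y\<in>borel_measurable (past_sigma M e t). AE \<omega> in M. s u \<omega> = Y \<omega>" if "u < t"
  proof (intro bexI)
    let ?Y = "\<lambda>\<omega>. \<chi> i. \<Sum>k. c k * w i (u - int k) \<omega>"
    have "AE \<omega> in M. \<forall>i. s u \<omega> $ i = (\<Sum>k. c k * w i (u - int k) \<omega>)"
      using causal(1) by (simp add: AE_all_countable)
    then show "AE \<omega> in M. s u \<omega> = ?Y \<omega>"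
      by eventually_elim (simp add: vec_eq_iff)
    have "(\<lambda>\<omega>. e v \<omega> $ j) \<in> borel_measurable (past_sigma M e t)" if "v \<le> u" for v j
      using measurable_past_sigma[of v t e M] that \<open>u < t\<close> borel_measurable_vec_iff[of "e v"] by auto
    then have "w i (u - int k) \<in> borel_measurable (past_sigma M e t)" for i k
      unfolding w_eq[abs_def] by (intro borel_measurable_sum borel_measurable_times) auto
    then show "?Y \<in> borel_measurable (past_sigma M e t)"
      by (simp add: borel_measurable_vec_iff)
  qed
qed

text \<open>Given the autoregression, its linear part is measurable with respect to the past of \<open>x\<close>, and the
  noise term integrates to 0 over every event of that past: up to null sets such an event belongs to
  the past of \<open>e\<close>, of which \<open>e t\<close> is independent, and \<open>e t\<close> is centred. By its defining property the
  conditional expectation is the linear part.\<close>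

lemma (in prob_space) innovation_eq:
  fixes x :: "int \<Rightarrow> 'a \<Rightarrow> real ^ 'x" and e :: "int \<Rightarrow> 'a \<Rightarrow> real ^ 'e" and C :: "real ^ 'e ^ 'x"
  assumes e: "iid_noise M e"
    and x_meas: "\<And>u. x u \<in> borel_measurable M"
    and x_int: "\<And>u i. integrable M (\<lambda>\<omega>. x u \<omega> $ i)"
    and past: "\<And>u. u < t \<Longrightarrow> \<exists>Y\<in>borel_measurable (past_sigma M e t). AE \<omega> in M. x u \<omega> = Y \<omega>"
    and eq: "AE \<omega> in M. x t \<omega> = (\<Sum>n = 1..L. F n *v x (t - int n) \<omega>) + C *v e t \<omega>"
  shows "AE \<omega> in M. innovation M x t \<omega> = C *v e t \<omega>"
proof -
  let ?G = "past_sigma M x t"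
  define g where "g i \<omega> = (\<Sum>n = 1..L. F n *v x (t - int n) \<omega>) $ i" for i \<omega>
  have g_eq: "g i \<omega> = (\<Sum>n = 1..L. \<Sum>j\<in>UNIV. F n $ i $ j * x (t - int n) \<omega> $ j)" for i \<omega>
    by (simp add: g_def sum_component matrix_vector_mult_def)
  interpret finite_measure_subalgebra M ?G
    by unfold_locales (rule subalgebra_past_sigma[where X = x, OF x_meas])
  have e_meas: "e u \<in> borel_measurable M" for u
    using e by (simp add: iid_noise_def indep_vars_def2)
  have sub_e: "subalgebra M (past_sigma M e t)"
    by (rule subalgebra_past_sigma[where X = e, OF e_meas])
  have g_int: "integrable M (g i)" for i
    unfolding g_eq[abs_def]
    by (intro Bochner_Integration.integrable_sum integrable_mult_right x_int)
  have g_meas: "g i \<in> borel_measurable ?G" for i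
  proof -
    have "(\<lambda>\<omega>. x (t - int n) \<omega> $ j) \<in> borel_measurable ?G" if "n \<in> {1..L}" for n j
      using measurable_past_sigma[of "t - int n" t x M] that
        borel_measurable_vec_iff[of "x (t - int n)"] by auto
    then show ?thesis
      unfolding g_eq[abs_def] by (intro borel_measurable_sum borel_measurable_times) auto
  qed
  have orth: "(\<integral>\<omega>. indicator S \<omega> * e t \<omega> $ j \<partial>M) = 0" if S: "S \<in> sets ?G" for S j
  proof -
    obtain S' where S': "S' \<in> sets (past_sigma M e t)" "AE \<omega> in M. \<omega> \<in> S \<longleftrightarrow> \<omega> \<in> S'"
      using past_sigma_AE_approximation[OF sub_e past S] by blast
    have "S \<in> events" "S' \<in> events"
      using S S'(1) subalg sub_e by (auto simp: subalgebra_def)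
    have nth: "(\<lambda>v :: real ^ 'e. v $ j) \<in> borel_measurable borel"
      by (intro borel_measurable_continuous_onI continuous_intros)
    have ej: "(\<lambda>\<omega>. e t \<omega> $ j) \<in> borel_measurable M"
      by (rule measurable_compose[OF e_meas nth])
    have "(\<integral>\<omega>. indicator S \<omega> * e t \<omega> $ j \<partial>M) = (\<integral>\<omega>. indicator S' \<omega> * e t \<omega> $ j \<partial>M)"
    proof (rule integral_cong_AE)
      show "AE \<omega> in M. indicator S \<omega> * e t \<omega> $ j = indicator S' \<omega> * e t \<omega> $ j"
        using S'(2) by eventually_elim (simp add: indicator_def)
    qed (use \<open>S \<in> events\<close> \<open>S' \<in> events\<close> ej in auto)
    also have "\<dots> = prob S' * (\<integral>\<omega>. e t \<omega> $ j \<partial>M)"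
      by (rule integral_past_times_present[where g = "\<lambda>v. v $ j", OF _ S'(1) nth])
        (use e iid_noise_component(1)[OF e] in \<open>auto simp: iid_noise_def\<close>)
    finally show ?thesis by (simp add: iid_noise_component(2)[OF e])
  qed
  have "AE \<omega> in M. real_cond_exp M ?G (\<lambda>\<omega>. x t \<omega> $ i) \<omega> = g i \<omega>" for i
  proof (rule real_cond_exp_charact)
    fix S assume S: "S \<in> sets ?G"
    then have S_M: "S \<in> events" using subalg by (auto simp: subalgebra_def)
    have int_ind: "integrable M (\<lambda>\<omega>. indicator S \<omega> * f \<omega>)" if "integrable M f" for f :: "'a \<Rightarrow> real"
      using integrable_mult_indicator[OF S_M that] by simp
    have e_int: "integrable M (\<lambda>\<omega>. indicator S \<omega> * e t \<omega> $ j)" for j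
      by (rule int_ind) (rule iid_noise_component(1)[OF e])
    have "(\<integral>\<omega>. indicator S \<omega> * x t \<omega> $ i \<partial>M)
        = (\<integral>\<omega>. indicator S \<omega> * g i \<omega> + (\<Sum>j\<in>UNIV. C $ i $ j * (indicator S \<omega> * e t \<omega> $ j)) \<partial>M)"
    proof (rule integral_cong_AE)
      show "(\<lambda>\<omega>. indicator S \<omega> * x t \<omega> $ i) \<in> borel_measurable M"
        using int_ind[OF x_int] by auto
      show "(\<lambda>\<omega>. indicator S \<omega> * g i \<omega> + (\<Sum>j\<in>UNIV. C $ i $ j * (indicator S \<omega> * e t \<omega> $ j)))
          \<in> borel_measurable M"
        by (intro borel_measurable_integrable Bochner_Integration.integrable_add
            Bochner_Integration.integrable_sum integrable_mult_right e_int int_ind[OF g_int])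
      show "AE \<omega> in M. indicator S \<omega> * x t \<omega> $ i
          = indicator S \<omega> * g i \<omega> + (\<Sum>j\<in>UNIV. C $ i $ j * (indicator S \<omega> * e t \<omega> $ j))"
        using eq
      proof eventually_elim
        case (elim \<omega>)
        then have "x t \<omega> $ i = g i \<omega> + (\<Sum>j\<in>UNIV. C $ i $ j * e t \<omega> $ j)"
          by (simp add: g_def matrix_vector_mult_def)
        then show ?case
          by (simp add: indicator_def)
      qed
    qed
    also have "\<dots> = (\<integral>\<omega>. indicator S \<omega> * g i \<omega> \<partial>M)
        + (\<Sum>j\<in>UNIV. C $ i $ j * (\<integral>\<omega>. indicator S \<omega> * e t \<omega> $ j \<partial>M))"
      by (simp add: Bochner_Integration.integral_add Bochner_Integration.integral_sum
          Bochner_Integration.integrable_sum int_ind[OF g_int] e_int)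
    finally show "(\<integral>\<omega>\<in>S. x t \<omega> $ i \<partial>M) = (\<integral>\<omega>\<in>S. g i \<omega> \<partial>M)"
      by (simp add: orth[OF S] set_lebesgue_integral_def)
  qed (use x_int g_int g_meas in auto)
  then have "AE \<omega> in M. \<forall>i. real_cond_exp M ?G (\<lambda>\<omega>. x t \<omega> $ i) \<omega> = g i \<omega>"
    by (simp add: AE_all_countable)
  then show ?thesis
    using eq
  proof eventually_elim
    case (elim \<omega>)
    then have "vec_cond_exp M ?G (x t) \<omega> = (\<Sum>n = 1..L. F n *v x (t - int n) \<omega>)"
      by (simp add: vec_cond_exp_def vec_eq_iff g_def)
    then show ?case
      using elim(2) by (simp add: innovation_def)
  qed
qed

theorem mainTheorem1:
  fixes M :: "'a measure"
    and e :: "int \<Rightarrow> 'a \<Rightarrow> real ^ 'e"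
    and s :: "int \<Rightarrow> 'a \<Rightarrow> real ^ 's"
    and x :: "int \<Rightarrow> 'a \<Rightarrow> real ^ 'x"
    and A :: "real ^ 's ^ 'x"
    and P :: "nat \<Rightarrow> real ^ 's ^ 's"
    and Q :: "nat \<Rightarrow> real ^ 'e ^ 's"
    and p q K :: nat
    and d :: "nat \<Rightarrow> nat"
    and blk :: "'e \<Rightarrow> nat"
  assumes "prob_space M"
    and "CARD('x) > CARD('e)"
    and "iid_noise M e"
    and "\<And>i. blk i < K"
    and "\<And>m. m < K \<Longrightarrow> card {i. blk i = m} = d m"
    and "(\<Sum>m<K. d m) = CARD('e)"
    and "independent_blocks M K blk e"
    and "pmat_stable (ar_pmat p P)"
    and "rank A = CARD('s)"
    and "\<exists>W :: real poly ^ 's ^ 'e. W ** ma_pmat q Q = mat 1"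
    and "stationary_process M s"
    and "\<And>t. AE \<omega> in M. pmat_act (ar_pmat p P) (\<lambda>u. s u \<omega>) t
                        = pmat_act (ma_pmat q Q) (\<lambda>u. e u \<omega>) t"
    and "\<And>t. x t \<in> borel_measurable M"
    and "\<And>t. AE \<omega> in M. x t \<omega> = A *v s t \<omega>"
  shows "autoregressive M x \<and>
         (\<forall>t. AE \<omega> in M. innovation M x t \<omega> = (A ** Q 0) *v e t \<omega>) \<and>
         (\<exists>W_AR :: real poly ^ 'x ^ 'x. \<forall>t. AE \<omega> in M.
            pmat_act W_AR (\<lambda>u. x u \<omega>) t = (A ** Q 0) *v e t \<omega>)"
proof -
  interpret prob_space M by fact
  note e = \<open>iid_noise M e\<close> and x_meas = \<open>\<And>t. x t \<in> borel_measurable M\<close>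
  obtain W :: "real poly ^ 's ^ 'e" where W: "W ** ma_pmat q Q = mat 1" using assms(10) by blast
  obtain B where B: "B ** A = mat 1"
    using assms(9) full_rank_injective matrix_left_invertible_injective by blast
  obtain V :: "real poly ^ 'x ^ 'x" where V0: "pmat_coeff V 0 = mat 1"
    and V: "\<And>x s e t. (\<And>u. x u = A *v s u)
        \<Longrightarrow> (\<And>u. pmat_act (ar_pmat p P) s u = pmat_act (ma_pmat q Q) e u)
        \<Longrightarrow> pmat_act V x t = (A ** Q 0) *v e t"
    using exists_ar_operator[OF B W, of p P] by blast
  have arma: "AE \<omega> in M. \<forall>u. pmat_act (ar_pmat p P) (\<lambda>u. s u \<omega>) u
      = pmat_act (ma_pmat q Q) (\<lambda>u. e u \<omega>) u"
    using assms(12) by (simp add: AE_all_countable)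
  have xs: "AE \<omega> in M. \<forall>u. x u \<omega> = A *v s u \<omega>"
    using assms(14) by (simp add: AE_all_countable)
  have Vx: "AE \<omega> in M. pmat_act V (\<lambda>u. x u \<omega>) t = (A ** Q 0) *v e t \<omega>" for t
    using arma xs
  proof eventually_elim
    case (elim \<omega>)
    show ?case
      by (rule V[of "\<lambda>u. x u \<omega>" "\<lambda>u. s u \<omega>" "\<lambda>u. e u \<omega>" t]) (use elim in auto)
  qed
  define F where "F n = - pmat_coeff V n" for n
  let ?L = "pmat_degree V"
  have ar: "AE \<omega> in M. x t \<omega> = (\<Sum>n = 1..?L. F n *v x (t - int n) \<omega>) + (A ** Q 0) *v e t \<omega>" for t
    using Vx[of t]
  proof eventually_elim
    case (elim \<omega>)
    have neg: "(- D) *v y = - (D *v y)" for D :: "real ^ 'x ^ 'x" and y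
      by (simp add: vec_eq_iff matrix_vector_mult_def sum_negf)
    have "{..?L} = insert 0 {1..?L}" by auto
    then have "pmat_act V (\<lambda>u. x u \<omega>) t = x t \<omega> + (\<Sum>n = 1..?L. pmat_coeff V n *v x (t - int n) \<omega>)"
      by (simp add: pmat_act_def V0)
    then show ?case
      using elim by (simp add: F_def neg sum_negf algebra_simps)
  qed
  note causal = stationary_arma_causal[OF e assms(8) assms(11) arma]
  have x_int: "integrable M (\<lambda>\<omega>. x u \<omega> $ i)" for u i
  proof -
    have "integrable M (\<lambda>\<omega>. \<Sum>j\<in>UNIV. A $ i $ j * s u \<omega> $ j)"
      by (intro Bochner_Integration.integrable_sum integrable_mult_right causal(1))
    moreover have "AE \<omega> in M. x u \<omega> $ i = (\<Sum>j\<in>UNIV. A $ i $ j * s u \<omega> $ j)"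
      using assms(14)[of u] by eventually_elim (simp add: matrix_vector_mult_def)
    ultimately show ?thesis
      using x_meas[of u] by (subst integrable_cong_AE) (auto simp: borel_measurable_vec_iff)
  qed
  have past: "\<exists>Y\<in>borel_measurable (past_sigma M e t). AE \<omega> in M. x u \<omega> = Y \<omega>" if ut: "u < t" for u t
  proof -
    obtain Y where Y: "Y \<in> borel_measurable (past_sigma M e t)" "AE \<omega> in M. s u \<omega> = Y \<omega>"
      using causal(2)[OF ut] by blast
    have "(\<lambda>\<omega>. A *v Y \<omega>) \<in> borel_measurable (past_sigma M e t)"
      using Y(1) by (auto simp: borel_measurable_vec_iff matrix_vector_mult_def
          intro!: borel_measurable_sum borel_measurable_times)
    moreover have "AE \<omega> in M. x u \<omega> = A *v Y \<omega>"
      using assms(14)[of u] Y(2) by eventually_elim simp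
    ultimately show ?thesis by (intro bexI[of _ "\<lambda>\<omega>. A *v Y \<omega>"])
  qed
  have innov: "AE \<omega> in M. innovation M x t \<omega> = (A ** Q 0) *v e t \<omega>" for t
    by (rule innovation_eq[OF e x_meas x_int past ar])
  have "AE \<omega> in M. x t \<omega> = (\<Sum>n = 1..?L. F n *v x (t - int n) \<omega>) + innovation M x t \<omega>" for t
    using ar[of t] innov[of t] by eventually_elim simp
  then have "autoregressive M x"
    unfolding autoregressive_def by (intro exI allI)
  then show ?thesis
    by (intro conjI allI innov exI[of _ V] Vx)
qed

end
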